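(* For every $\Delta\in\mathbb{N}$ there exists a constant $C=C(\Delta)$ such that every (finite) $3$-uniform hypergraph $\mathcal{H}$ of maximum degree at most $\Delta$ satisfies $R(\mathcal{H})\le C|\mathcal{H}|$.
   Context: A $3$-uniform hypergraph consists of a finite vertex set and a set of hyperedges, each hyperedge being a set of exactly $3$ vertices. $|\mathcal{H}|$ denotes the number of vertices of $\mathcal{H}$. The degree of a vertex $x$ in $\mathcal{H}$ is the number of hyperedges containing $x$, and the maximum degree of $\mathcal{H}$ is the maximum of the degrees of its vertices. The Ramsey number $R(\mathcal{H})$ is the smallest $N\in\mathbb{N}$ such that every colouring of the hyperedges of the complete $3$-uniform hypergraph on $N$ vertices with two colours contains a monochromatic copy of $\mathcal{H}$ (i.e. a not necessarily induced subhypergraph isomorphic to $\mathcal{H}$ all of whose hyperedges have the same colour). *)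

theory Defs
  imports Complex_Main "HOL-Library.Ramsey"
begin

text \<open>
  A 3-uniform hypergraph is given by its vertex set \<open>V\<close> and its set of hyperedges \<open>E\<close>;
  \<open>nsets V 3\<close> is the set of all 3-element subsets of \<open>V\<close>.
\<close>

definition hypergraph3 :: "'a set \<Rightarrow> 'a set set \<Rightarrow> bool" where
  "hypergraph3 V E \<longleftrightarrow> finite V \<and> E \<subseteq> nsets V 3"

definition vertex_degree :: "'a set set \<Rightarrow> 'a \<Rightarrow> nat" where
  "vertex_degree E x = card {e \<in> E. x \<in> e}"

text \<open>The inserted \<open>0\<close> only matters for \<open>V = {}\<close>, where the maximum degree is \<open>0\<close> by convention.\<close>

definition max_degree :: "'a set \<Rightarrow> 'a set set \<Rightarrow> nat" where
  "max_degree V E = Max (insert 0 (vertex_degree E ` V))"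

definition subhypergraph :: "'a set \<Rightarrow> 'a set set \<Rightarrow> 'a set \<Rightarrow> 'a set set \<Rightarrow> bool" where
  "subhypergraph W F V E \<longleftrightarrow> hypergraph3 W F \<and> W \<subseteq> V \<and> F \<subseteq> E"

definition hypergraph_iso :: "'a set \<Rightarrow> 'a set set \<Rightarrow> 'b set \<Rightarrow> 'b set set \<Rightarrow> bool" where
  "hypergraph_iso V E W F \<longleftrightarrow> (\<exists>f. bij_betw f V W \<and> F = (\<lambda>e. f ` e) ` E)"

text \<open>
  A colouring of the complete 3-uniform hypergraph on \<open>{..<N}\<close> is a function into \<^typ>\<open>bool\<close>
  of which only the values on \<open>nsets {..<N} 3\<close> matter.
\<close>

definition arrows :: "nat \<Rightarrow> 'a set \<Rightarrow> 'a set set \<Rightarrow> bool" where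
  "arrows N V E \<longleftrightarrow>
     (\<forall>c :: nat set \<Rightarrow> bool. \<exists>W F.
        subhypergraph W F {..<N} (nsets {..<N} 3) \<and> hypergraph_iso V E W F \<and>
        (\<exists>b. \<forall>e\<in>F. c e = b))"

definition ramsey_number :: "'a set \<Rightarrow> 'a set set \<Rightarrow> nat" where
  "ramsey_number V E = (LEAST N. arrows N V E)"

text \<open>By Ramsey's theorem the minimum above is over a nonempty set.\<close>

lemma ex_arrows:
  assumes "hypergraph3 V E"
  shows "\<exists>N. arrows N V E"
proof -
  have fin: "finite V" and E: "E \<subseteq> nsets V 3"
    using assms by (auto simp: hypergraph3_def)
  obtain N :: nat where N: "partn_lst {..<N} [card V, card V] 3"
    using ramsey_full by blast
  have "\<exists>W F. subhypergraph W F {..<N} (nsets {..<N} 3) \<and> hypergraph_iso V E W F \<and>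
        (\<exists>b. \<forall>e\<in>F. c e = b)" for c :: "nat set \<Rightarrow> bool"
  proof -
    define g where "g e = (if c e then 0 else 1 :: nat)" for e
    have "g \<in> nsets {..<N} 3 \<rightarrow> {..<length [card V, card V]}"
      by (auto simp: g_def)
    then obtain i W where i: "i < length [card V, card V]"
      and W: "W \<in> nsets {..<N} ([card V, card V] ! i)"
      and mono: "g ` nsets W 3 \<subseteq> {i}"
      using N unfolding partn_lst_def monochromatic_def by blast
    have cW: "card W = card V" "W \<subseteq> {..<N}" "finite W"
      using W i by (auto simp: nsets_def less_Suc_eq)
    then obtain f where f: "bij_betw f V W"
      using fin by (metis finite_same_card_bij)
    define F where "F = (\<lambda>e. f ` e) ` E"
    have F: "F \<subseteq> nsets W 3"
    proof -
      have "f ` e \<in> nsets W 3" if "e \<in> E" for e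
      proof -
        have e: "e \<subseteq> V" "finite e" "card e = 3" using that E by (auto simp: nsets_def)
        have "inj_on f e" using f e(1) by (meson bij_betw_def inj_on_subset)
        then show ?thesis
          using e f by (auto simp: nsets_def card_image bij_betw_def)
      qed
      then show ?thesis by (auto simp: F_def)
    qed
    have "g e = i" if "e \<in> F" for e using mono F that by blast
    then have "\<forall>e\<in>F. c e = (i = 0)"
      by (metis g_def zero_neq_one)
    moreover have "F \<subseteq> nsets {..<N} 3"
      using F cW nsets_mono by blast
    ultimately show ?thesis
      using F cW f unfolding subhypergraph_def hypergraph_iso_def hypergraph3_def F_def by blast
  qed
  then show ?thesis unfolding arrows_def by blast
qed

end

theory Submission
  imports Defs
begin

text \<open>
  Fix \<open>\<Delta>\<close>, and let \<open>X\<close> be the set of \<open>N\<close> vertices whose triples are coloured. By greedy colouring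
  the vertices of a hypergraph of maximum degree \<open>\<Delta>\<close> fall into \<open>M = 2 * \<Delta> + 1\<close> classes such that
  every hyperedge meets three different classes. The proof picks one point \<open>v i\<close> of \<open>X\<close> for each
  class \<open>i\<close> so that all triples of these points have the same colour. Sending each vertex to the
  point of its class is then a monochromatic homomorphism, only far from injective. It is turned
  into an embedding by replacing, class by class, the image \<open>v (\<chi> x)\<close> of each vertex \<open>x\<close> by a
  new point \<open>f x\<close>, while all hyperedges keep the colour.

  The admissible points for \<open>x\<close> are determined by the at most \<open>2 * \<Delta>\<close> points already chosen for
  its neighbours in earlier classes, and by the points \<open>v j\<close> of later classes. The step works if there
  are at least \<open>\<delta> i * N\<close> admissible points, \<open>i = \<chi> x\<close>. Call a choice of points for the earlier
  neighbours deceptive if \<open>v i\<close> itself is admissible but fewer than \<open>\<delta> i * N\<close> points are. For a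
  uniformly random \<open>v\<close> deceptive choices are rare: once everything except \<open>v i\<close> is fixed, a small
  admissible set is hit by \<open>v i\<close> with probability less than \<open>\<delta> i\<close>. There are only boundedly many
  shapes of the neighbourhood of \<open>x\<close>, so some injective \<open>v\<close> has, for both colours, every class and
  every shape, at most a proportion \<open>\<eta> i\<close> of deceptive choices (\<open>exists_honest_template\<close>). To
  have this for both colours before a colour is selected, \<open>v\<close> is given \<open>r\<close> points, \<open>r\<close> a Ramsey
  number; Ramsey's theorem for the triples of the finite set \<open>{..<r}\<close> then yields \<open>M\<close> of these points
  all of whose triples have the same colour, and their indices are used as the classes.

  During the embedding, the proportion of deceptive choices among those extending the points chosen so
  far is kept, for each unembedded vertex \<open>z\<close> of class \<open>j\<close>, at most \<open>\<eta> j * K j ^ k\<close>, where \<open>k\<close> counts the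
  embedded earlier neighbours of \<open>z\<close>. The average over a new point leaves this proportion
  unchanged, so by Markov's inequality only \<open>N / K j\<close> points violate the bound, and with
  \<open>K j \<ge> 2 * M / \<delta> i\<close> for all \<open>i < j\<close> such points, together with the at most \<open>card V\<close>
  occupied ones, do not exhaust the admissible ones (\<open>safe_extend\<close>). As \<open>\<eta> j * K j ^ M < 1\<close>, the actual
  choice is not deceptive when the turn of \<open>z\<close> comes, so \<open>z\<close> has many admissible points
  (\<open>many_candidates\<close>). The constants are found in the order \<open>\<delta> 0, K 1, \<eta> 1, \<delta> 1, K 2, \<dots>\<close> and depend on
  \<open>\<Delta>\<close> only; it is the occupied points that make \<open>N\<close> depend on \<open>card V\<close>, and hence linearly.
\<close>

section \<open>Averages over random functions\<close>

text \<open>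
  Redrawing one coordinate of a uniformly random function does not change its distribution. The
  bijection behind this swaps the old and the new value of the coordinate \<open>i\<close>.
\<close>
lemma sum_resample_PiE:
  fixes g :: "('i \<Rightarrow> 'b) \<Rightarrow> 'c::comm_semiring_1"
  assumes "i \<in> J"
  shows "(\<Sum>a\<in>J \<rightarrow>\<^sub>E X. \<Sum>y\<in>X. g (a(i := y))) = of_nat (card X) * (\<Sum>a\<in>J \<rightarrow>\<^sub>E X. g a)"
proof -
  let ?F = "J \<rightarrow>\<^sub>E X"
  have "(\<Sum>a\<in>?F. \<Sum>y\<in>X. g (a(i := y))) = (\<Sum>(a, y)\<in>?F \<times> X. g (a(i := y)))"
    by (simp add: sum.cartesian_product)
  also have "\<dots> = (\<Sum>(a, y)\<in>?F \<times> X. g a)"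
    using assms
    by (intro sum.reindex_bij_witness[where i = "\<lambda>(a, y). (a(i := y), a i)"
          and j = "\<lambda>(a, y). (a(i := y), a i)"]) (auto simp: PiE_def extensional_def)
  also have "\<dots> = of_nat (card X) * (\<Sum>a\<in>?F. g a)"
    by (simp add: sum.cartesian_product[symmetric] sum_distrib_left)
  finally show ?thesis .
qed

lemma card_Collect_eq_sum:
  assumes "finite A"
  shows "real (card {a \<in> A. Q a}) = (\<Sum>a\<in>A. of_bool (Q a))"
  using assms by (simp add: Int_def)

lemma sum_card_resample_PiE:
  assumes "i \<in> J" "finite J" "finite X"
  shows "(\<Sum>y\<in>X. real (card {a \<in> J \<rightarrow>\<^sub>E X. Q (a(i := y))}))
    = real (card X) * real (card {a \<in> J \<rightarrow>\<^sub>E X. Q a})"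
proof -
  have fin: "finite (J \<rightarrow>\<^sub>E X)" using assms by (simp add: finite_PiE)
  have "(\<Sum>y\<in>X. real (card {a \<in> J \<rightarrow>\<^sub>E X. Q (a(i := y))}))
    = (\<Sum>a\<in>J \<rightarrow>\<^sub>E X. \<Sum>y\<in>X. of_bool (Q (a(i := y))))"
    unfolding card_Collect_eq_sum[OF fin] by (rule sum.swap)
  also have "\<dots> = real (card X) * (\<Sum>a\<in>J \<rightarrow>\<^sub>E X. of_bool (Q a))"
    using sum_resample_PiE[OF assms(1), where g = "\<lambda>a. of_bool (Q a) :: real" and X = X] by simp
  finally show ?thesis unfolding card_Collect_eq_sum[OF fin] .
qed

lemma markov_card:
  fixes f :: "'b \<Rightarrow> real"
  assumes "finite A" "\<And>y. y \<in> A \<Longrightarrow> f y \<ge> 0"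
  shows "t * card {y \<in> A. f y > t} \<le> sum f A"
proof -
  have "t * card {y \<in> A. f y > t} = (\<Sum>y\<in>{y \<in> A. f y > t}. t)" by simp
  also have "\<dots> \<le> (\<Sum>y\<in>{y \<in> A. f y > t}. f y)" by (rule sum_mono) auto
  also have "\<dots> \<le> sum f A" using assms by (intro sum_mono2) auto
  finally show ?thesis .
qed

section \<open>Random templates\<close>

text \<open>
  The shape of the neighbourhood of a vertex is encoded as a set \<open>P\<close> of pairs of indices: a hyperedge
  through the vertex is the pair of indices of its two other vertices. An index below \<open>M\<close> names
  a slot, whose point is given by a function \<open>a\<close>, and \<open>M + j\<close> stands for the template
  point \<open>v j\<close>. In this form there are at most \<open>2 ^ ((M + r)\<^sup>2)\<close> shapes, independently of the hypergraph,
  which makes a union bound over all shapes affordable. Neighbours shared by several hyperedges are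
  handled correctly because they occupy one slot only.
\<close>
definition extensions :: "'b set \<Rightarrow> 'b set set \<Rightarrow> (nat \<times> nat) set \<Rightarrow> (nat \<Rightarrow> 'b) \<Rightarrow> 'b set" where
  "extensions X R P b = {y \<in> X. \<forall>(j, k)\<in>P. {b j, b k, y} \<in> R}"

definition join :: "nat \<Rightarrow> (nat \<Rightarrow> 'b) \<Rightarrow> (nat \<Rightarrow> 'b) \<Rightarrow> nat \<Rightarrow> 'b" where
  "join M a v k = (if k < M then a k else v (k - M))"

definition deceptive ::
  "'b set \<Rightarrow> 'b set set \<Rightarrow> nat \<Rightarrow> real \<Rightarrow> (nat \<times> nat) set \<Rightarrow> nat \<Rightarrow> (nat \<Rightarrow> 'b) \<Rightarrow> (nat \<Rightarrow> 'b) \<Rightarrow> bool"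
  where "deceptive X R M \<delta> P i v a \<longleftrightarrow>
    v i \<in> extensions X R P (join M a v) \<and>
    real (card (extensions X R P (join M a v))) < \<delta> * real (card X)"

text \<open>
  As \<open>P\<close> does not mention the index \<open>M + i\<close>, the set of extensions does not depend on the point \<open>v i\<close>;
  so when \<open>v i\<close> is redrawn, a set of fewer than \<open>\<delta> * card X\<close> extensions is hit with probability less
  than \<open>\<delta>\<close>.
\<close>
lemma deceptive_rare_on_average:
  assumes X: "finite X" "X \<noteq> {}" and "i < r" "\<delta> \<ge> 0" "M + i \<notin> fst ` P \<union> snd ` P"
  shows "(\<Sum>v\<in>{..<r} \<rightarrow>\<^sub>E X. real (card {a \<in> {..<M} \<rightarrow>\<^sub>E X. deceptive X R M \<delta> P i v a}))
    \<le> \<delta> * real (card ({..<r} \<rightarrow>\<^sub>E X)) * real (card ({..<M} \<rightarrow>\<^sub>E X))"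
proof -
  let ?U = "{..<r} \<rightarrow>\<^sub>E X" and ?F = "{..<M} \<rightarrow>\<^sub>E X"
  have fin: "finite ?U" "finite ?F" using X by (auto intro!: finite_PiE)
  have N: "real (card X) > 0" using X by (simp add: card_gt_0_iff)
  have for_a: "(\<Sum>v\<in>?U. of_bool (deceptive X R M \<delta> P i v a)) \<le> \<delta> * real (card ?U)" for a
  proof -
    have for_v: "(\<Sum>y\<in>X. of_bool (deceptive X R M \<delta> P i (v(i := y)) a)) \<le> \<delta> * real (card X)" for v
    proof -
      have join: "join M a (v(i := y)) k = join M a v k" if "k \<noteq> M + i" for y k
        using that by (auto simp: join_def)
      have "j \<noteq> M + i \<and> k \<noteq> M + i" if "(j, k) \<in> P" for j k using that assms(5) by force
      then have ext: "extensions X R P (join M a (v(i := y))) = extensions X R P (join M a v)" for y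
        unfolding extensions_def
        by (intro Collect_cong conj_cong refl ball_cong) (clarsimp simp: join)
      have "(\<Sum>y\<in>X. of_bool (deceptive X R M \<delta> P i (v(i := y)) a))
          = real (card {y \<in> X. deceptive X R M \<delta> P i (v(i := y)) a})"
        using X(1) by (simp add: card_Collect_eq_sum)
      also have "\<dots> \<le> \<delta> * real (card X)"
      proof (cases "real (card (extensions X R P (join M a v))) < \<delta> * real (card X)")
        case True
        have "card {y \<in> X. deceptive X R M \<delta> P i (v(i := y)) a} \<le> card (extensions X R P (join M a v))"
          using X(1) by (intro card_mono) (auto simp: deceptive_def ext, auto simp: extensions_def)
        with True show ?thesis by linarith
      next
        case False
        then have "{y \<in> X. deceptive X R M \<delta> P i (v(i := y)) a} = {}" by (auto simp: deceptive_def ext)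
        then show ?thesis using \<open>\<delta> \<ge> 0\<close> by (metis card.empty of_nat_0 of_nat_0_le_iff mult_nonneg_nonneg)
      qed
      finally show ?thesis .
    qed
    have "real (card X) * (\<Sum>v\<in>?U. of_bool (deceptive X R M \<delta> P i v a))
        = (\<Sum>v\<in>?U. \<Sum>y\<in>X. of_bool (deceptive X R M \<delta> P i (v(i := y)) a))"
      using \<open>i < r\<close> by (intro sum_resample_PiE[symmetric]) simp
    also have "\<dots> \<le> (\<Sum>v\<in>?U. \<delta> * real (card X))" by (intro sum_mono for_v)
    also have "\<dots> = real (card X) * (\<delta> * real (card ?U))" by simp
    finally show ?thesis using N by simp
  qed
  have "(\<Sum>v\<in>?U. real (card {a \<in> ?F. deceptive X R M \<delta> P i v a}))
      = (\<Sum>a\<in>?F. \<Sum>v\<in>?U. of_bool (deceptive X R M \<delta> P i v a))"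
    unfolding card_Collect_eq_sum[OF fin(2)] by (rule sum.swap)
  also have "\<dots> \<le> (\<Sum>a\<in>?F. \<delta> * real (card ?U))" by (intro sum_mono for_a)
  finally show ?thesis by (simp add: mult_ac)
qed

lemma card_PiE_coincidence:
  fixes X :: "'b set" and p q r :: nat
  assumes "finite X" "X \<noteq> {}" "p < r" "q < r" "p \<noteq> q"
  shows "real (card X) * real (card {v \<in> {..<r} \<rightarrow>\<^sub>E X. v p = v q}) = real (card ({..<r} \<rightarrow>\<^sub>E X))"
proof -
  let ?U = "{..<r} \<rightarrow>\<^sub>E X"
  have fin: "finite ?U" using assms by (auto intro!: finite_PiE)
  have "real (card X) * real (card {v \<in> ?U. v p = v q}) =
     (\<Sum>v\<in>?U. \<Sum>y\<in>X. of_bool ((v(p := y)) p = (v(p := y)) q))"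
    unfolding card_Collect_eq_sum[OF fin] using assms by (intro sum_resample_PiE[symmetric]) simp
  also have "\<dots> = (\<Sum>v\<in>?U. 1)"
  proof (rule sum.cong[OF refl])
    fix v assume "v \<in> ?U"
    then have "v q \<in> X" using assms by auto
    then have "{y \<in> X. y = v q} = {v q}" by auto
    then have "X \<inter> {y. y = v q} = {v q}" by auto
    then show "(\<Sum>y\<in>X. of_bool ((v(p := y)) p = (v(p := y)) q)) = (1::real)"
      using assms by simp
  qed
  finally show ?thesis by simp
qed

text \<open>
  A union bound: less than half of all templates fail to be injective, as \<open>card X\<close> is large compared
  with the number of pairs of indices, and by Markov's inequality at most half of them admit too many
  deceptive choices for one of the at most \<open>2 * r * 2 ^ ((M + r)\<^sup>2)\<close> combinations of a colour, a
  class and a shape.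
\<close>
lemma exists_honest_template:
  fixes X :: "'b set" and R :: "bool \<Rightarrow> 'b set set" and \<delta> \<eta> :: "nat \<Rightarrow> real"
  assumes "finite X" "r > 0" and N: "card X > 2 * r\<^sup>2"
    and \<eta>: "\<And>i. i < r \<Longrightarrow> \<eta> i > 0" and \<delta>0: "\<And>i. i < r \<Longrightarrow> \<delta> i \<ge> 0"
    and \<delta>: "\<And>i. i < r \<Longrightarrow> \<delta> i * (4 * r * 2 ^ ((M + r)\<^sup>2)) \<le> \<eta> i"
  obtains v where "v \<in> {..<r} \<rightarrow>\<^sub>E X" "inj_on v {..<r}"
    "\<And>c i P. i < r \<Longrightarrow> P \<subseteq> ({..<M+r} - {M+i}) \<times> ({..<M+r} - {M+i}) \<Longrightarrow>
       real (card {a \<in> {..<M} \<rightarrow>\<^sub>E X. deceptive X (R c) M (\<delta> i) P i v a})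
         \<le> \<eta> i * real (card ({..<M} \<rightarrow>\<^sub>E X))"
proof -
  let ?U = "{..<r} \<rightarrow>\<^sub>E X" and ?F = "{..<M} \<rightarrow>\<^sub>E X"
  have X: "X \<noteq> {}" using N by auto
  have fin: "finite ?U" "finite ?F" using assms by (auto intro!: finite_PiE)
  have U: "real (card ?U) > 0" and F: "real (card ?F) > 0"
    using fin X by (auto simp: card_gt_0_iff PiE_eq_empty_iff)
  have Np: "real (card X) > 2 * real r ^ 2" using N by (metis of_nat_less_iff of_nat_mult of_nat_numeral of_nat_power)
  define Co where "Co = (\<lambda>(p, q). {v \<in> ?U. v p = v q})"
  define J where "J = {(p, q). p < r \<and> q < r \<and> p \<noteq> q}"
  have J: "finite J" "card J \<le> r\<^sup>2"
  proof -
    have *: "J \<subseteq> {..<r} \<times> {..<r}" by (auto simp: J_def)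
    then show "finite J" by (rule finite_subset) simp
    have "card J \<le> card ({..<r} \<times> {..<r})" using * by (intro card_mono) auto
    then show "card J \<le> r\<^sup>2" by (simp add: card_cartesian_product power2_eq_square)
  qed
  have "real (card (\<Union>(Co ` J))) \<le> (\<Sum>pq\<in>J. real (card (Co pq)))"
    using card_UN_le[OF J(1), of Co] by (metis of_nat_le_iff of_nat_sum)
  also have "\<dots> \<le> (\<Sum>pq\<in>J. real (card ?U) / real (card X))"
  proof (rule sum_mono)
    fix pq assume "pq \<in> J"
    then show "real (card (Co pq)) \<le> real (card ?U) / real (card X)"
      using card_PiE_coincidence[OF assms(1) X, of "fst pq" r "snd pq"] X assms(1)
      by (auto simp: J_def Co_def field_simps card_gt_0_iff split: prod.splits)
  qed
  also have "\<dots> \<le> real r ^ 2 * (real (card ?U) / real (card X))"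
    using J(2) by (simp, intro divide_right_mono mult_right_mono)
      (auto simp flip: of_nat_power)
  also have "\<dots> < real (card ?U) / 2"
    using Np U X assms(1) by (simp add: field_simps card_gt_0_iff)
  finally have part1: "real (card (\<Union>(Co ` J))) < real (card ?U) / 2" .
  define S where "S i = ({..<M+r} - {M+i}) \<times> ({..<M+r} - {M+i})" for i
  define I where "I = (UNIV :: bool set) \<times> (SIGMA i:{..<r}. Pow (S i))"
  define B where "B = (\<lambda>(c, i, P). {v \<in> ?U.
     real (card {a \<in> ?F. deceptive X (R c) M (\<delta> i) P i v a}) > \<eta> i * real (card ?F)})"
  have I: "finite I" "card I \<le> 2 * r * 2 ^ ((M + r)\<^sup>2)"
  proof -
    have *: "I \<subseteq> UNIV \<times> {..<r} \<times> Pow ({..<M+r} \<times> {..<M+r})" by (auto simp: I_def S_def)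
    then show "finite I" by (rule finite_subset) simp
    have "card I \<le> card ((UNIV::bool set) \<times> {..<r} \<times> Pow ({..<M+r} \<times> {..<M+r}))"
      using * by (intro card_mono) auto
    then show "card I \<le> 2 * r * 2 ^ ((M + r)\<^sup>2)"
      by (simp add: card_cartesian_product card_Pow power2_eq_square)
  qed
  have "real (card (\<Union>(B ` I))) \<le> (\<Sum>t\<in>I. real (card (B t)))"
    using card_UN_le[OF I(1), of B] by (metis of_nat_le_iff of_nat_sum)
  also have "\<dots> \<le> (\<Sum>t\<in>I. real (card ?U) / (4 * r * 2 ^ ((M + r)\<^sup>2)))"
  proof (rule sum_mono)
    fix t assume "t \<in> I"
    then obtain c i P where t: "t = (c, i, P)" "i < r" "P \<subseteq> S i" by (auto simp: I_def)
    let ?f = "\<lambda>v. real (card {a \<in> ?F. deceptive X (R c) M (\<delta> i) P i v a})"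
    define D where "D = 4 * real r * 2 ^ ((M + r)\<^sup>2)"
    have D: "D > 0" using \<open>r > 0\<close> by (simp add: D_def)
    have "\<eta> i * real (card ?F) * real (card (B t)) \<le> sum ?f ?U"
      unfolding t(1) B_def using markov_card[OF fin(1), of ?f "\<eta> i * real (card ?F)"] by simp
    also have "\<dots> \<le> \<delta> i * real (card ?U) * real (card ?F)"
      using t by (intro deceptive_rare_on_average assms X \<delta>0) (auto simp: S_def)
    finally have "\<eta> i * real (card (B t)) \<le> \<delta> i * real (card ?U)"
      using F by (simp add: field_simps)
    then have "\<eta> i * real (card (B t)) * D \<le> \<delta> i * real (card ?U) * D"
      using D by (intro mult_right_mono) auto
    also have "\<dots> = \<delta> i * D * real (card ?U)" by simp
    also have "\<dots> \<le> \<eta> i * real (card ?U)" using \<delta>[OF t(2)] U by (intro mult_right_mono) (auto simp: D_def)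
    finally have "real (card (B t)) * D \<le> real (card ?U)" using \<eta>[OF t(2)] by (simp add: mult.assoc)
    then show "real (card (B t)) \<le> real (card ?U) / (4 * r * 2 ^ ((M + r)\<^sup>2))"
      using D by (simp add: pos_le_divide_eq flip: D_def)
  qed
  also have "\<dots> = real (card I) * (real (card ?U) / (4 * r * 2 ^ ((M + r)\<^sup>2)))" by simp
  also have "\<dots> \<le> real (2 * r * 2 ^ ((M + r)\<^sup>2)) * (real (card ?U) / (4 * r * 2 ^ ((M + r)\<^sup>2)))"
    using I(2) by (intro mult_right_mono) (simp_all only: of_nat_le_iff, simp)
  also have "\<dots> = real (card ?U) / 2" using \<open>r > 0\<close> by (simp add: field_simps)
  finally have part2: "real (card (\<Union>(B ` I))) \<le> real (card ?U) / 2" .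
  have "card (\<Union>(Co ` J) \<union> \<Union>(B ` I)) < card ?U"
    using part1 part2 card_Un_le[of "\<Union>(Co ` J)" "\<Union>(B ` I)"] by linarith
  moreover have "\<Union>(Co ` J) \<union> \<Union>(B ` I) \<subseteq> ?U" by (auto simp: Co_def B_def)
  ultimately obtain v where v: "v \<in> ?U" "v \<notin> \<Union>(Co ` J)" "v \<notin> \<Union>(B ` I)"
    by (metis UnCI less_irrefl subsetI subset_antisym)
  show ?thesis
  proof
    show "v \<in> ?U" by fact
    show "inj_on v {..<r}" using v(1,2) by (force simp: inj_on_def Co_def J_def)
    fix c i P assume "i < r" "P \<subseteq> ({..<M+r} - {M+i}) \<times> ({..<M+r} - {M+i})"
    then have "(c, i, P) \<in> I" by (auto simp: I_def S_def)
    then show "real (card {a \<in> ?F. deceptive X (R c) M (\<delta> i) P i v a}) \<le> \<eta> i * real (card ?F)"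
      using v(1,3) by (force simp: B_def not_less)
  qed
qed

section \<open>Embedding a hypergraph along a template\<close>

definition shadow_nbrs :: "'a set set \<Rightarrow> 'a \<Rightarrow> 'a set" where
  "shadow_nbrs E x = {u. u \<noteq> x \<and> (\<exists>e\<in>E. x \<in> e \<and> u \<in> e)}"

lemma shadow_nbrs_sym: "u \<in> shadow_nbrs E x \<longleftrightarrow> x \<in> shadow_nbrs E u"
  by (auto simp: shadow_nbrs_def)

lemma shadow_nbrsI:
  assumes "{u, w, x} \<in> E"
  shows "u \<noteq> x \<Longrightarrow> u \<in> shadow_nbrs E x" "w \<noteq> x \<Longrightarrow> w \<in> shadow_nbrs E x"
  unfolding shadow_nbrs_def
  by (intro CollectI conjI bexI[OF _ assms]; simp)+

lemma hyperedge_obtain: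
  assumes "e \<in> nsets V 3" "x \<in> e"
  obtains u w where "e = {u, w, x}" "u \<noteq> w" "u \<noteq> x" "w \<noteq> x" "u \<in> V" "w \<in> V"
proof -
  from assms have "e \<subseteq> V" "card (e - {x}) = 2" by (auto simp: nsets_def)
  then obtain u w where "e - {x} = {u, w}" "u \<noteq> w" by (auto simp: card_2_iff)
  with assms \<open>e \<subseteq> V\<close> show ?thesis by (intro that[of u w]) auto
qed

text \<open>
  The classes of the colouring \<open>\<chi>\<close> are the indices of the template \<open>v\<close>, and \<open>R\<close> is the set of triples of
  the chosen colour. Assumption \<open>honest\<close> bounds the initial proportion of deceptive choices and \<open>K\<close> is
  the factor lost per embedded neighbour. The factors \<open>2\<close> in \<open>\<delta>_X\<close> and \<open>\<delta>_K\<close> reserve one half of the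
  admissible points for occupied points and the other half for points that make some
  other vertex too risky.
\<close>
locale template_embedding =
  fixes V :: "'a set" and E :: "'a set set" and \<chi> :: "'a \<Rightarrow> nat"
    and X :: "'b set" and R :: "'b set set" and r M :: nat and v :: "nat \<Rightarrow> 'b"
    and \<delta> \<eta> K :: "nat \<Rightarrow> real"
  assumes finite_V: "finite V" and E: "E \<subseteq> nsets V 3"
    and finite_X: "finite X" and X_nonempty: "X \<noteq> {}"
    and \<chi>_less: "x \<in> V \<Longrightarrow> \<chi> x < r"
    and proper: "\<lbrakk>x \<in> V; u \<in> shadow_nbrs E x\<rbrakk> \<Longrightarrow> \<chi> u \<noteq> \<chi> x"
    and shadow_degree: "x \<in> V \<Longrightarrow> card (shadow_nbrs E x) \<le> M"
    and v_in: "i < r \<Longrightarrow> v i \<in> X"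
    and v_edge: "e \<in> E \<Longrightarrow> v ` \<chi> ` e \<in> R"
    and honest: "\<lbrakk>x \<in> V; P \<subseteq> ({..<M+r} - {M+\<chi> x}) \<times> ({..<M+r} - {M+\<chi> x})\<rbrakk> \<Longrightarrow>
       real (card {a \<in> {..<M} \<rightarrow>\<^sub>E X. deceptive X R M (\<delta> (\<chi> x)) P (\<chi> x) v a})
         \<le> \<eta> (\<chi> x) * real (card ({..<M} \<rightarrow>\<^sub>E X))"
    and K_ge: "j < r \<Longrightarrow> K j \<ge> 1"
    and \<delta>_X: "i < r \<Longrightarrow> 2 * real (card V) < \<delta> i * real (card X)"
    and \<delta>_K: "i < j \<Longrightarrow> j < r \<Longrightarrow> 2 * real M \<le> \<delta> i * K j"
    and \<eta>_K: "j < r \<Longrightarrow> \<eta> j * K j ^ M < 1"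
begin

definition earlier :: "'a \<Rightarrow> 'a set" where
  "earlier x = {u \<in> shadow_nbrs E x. \<chi> u < \<chi> x}"

definition nth_earlier :: "'a \<Rightarrow> nat \<Rightarrow> 'a" where
  "nth_earlier x = (SOME h. bij_betw h {..<card (earlier x)} (earlier x))"

definition slot :: "'a \<Rightarrow> 'a \<Rightarrow> nat" where
  "slot x u = (if u \<in> earlier x then inv_into {..<card (earlier x)} (nth_earlier x) u else M + \<chi> u)"

definition pattern :: "'a \<Rightarrow> (nat \<times> nat) set" where
  "pattern x = {(slot x u, slot x w) | u w. {u, w, x} \<in> E \<and> u \<noteq> x \<and> w \<noteq> x}"

text \<open>
  The slots of embedded earlier neighbours carry their actual images, the others the values of \<open>a\<close>.
  Leaving superfluous slots to \<open>a\<close> as well means that proportions are always taken over the same set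
  \<open>{..<M} \<rightarrow>\<^sub>E X\<close>, however many neighbours have been embedded.
\<close>
definition fill :: "'a \<Rightarrow> 'a set \<Rightarrow> ('a \<Rightarrow> 'b) \<Rightarrow> (nat \<Rightarrow> 'b) \<Rightarrow> nat \<Rightarrow> 'b" where
  "fill x S f a k = (if k < card (earlier x) \<and> nth_earlier x k \<in> S then f (nth_earlier x k) else a k)"

definition risk :: "'a \<Rightarrow> 'a set \<Rightarrow> ('a \<Rightarrow> 'b) \<Rightarrow> real" where
  "risk x S f = real (card {a \<in> {..<M} \<rightarrow>\<^sub>E X.
     deceptive X R M (\<delta> (\<chi> x)) (pattern x) (\<chi> x) v (fill x S f a)})"

definition hybrid :: "'a set \<Rightarrow> ('a \<Rightarrow> 'b) \<Rightarrow> 'a \<Rightarrow> 'b" where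
  "hybrid S f u = (if u \<in> S then f u else v (\<chi> u))"

text \<open>
  The invariant of the embedding. \<open>S\<close> is the set of embedded vertices; it is closed under passing to
  smaller classes, so that the earlier neighbours of the next vertex are embedded and its later
  ones are not.
\<close>
definition safe :: "'a set \<Rightarrow> ('a \<Rightarrow> 'b) \<Rightarrow> bool" where
  "safe S f \<longleftrightarrow> S \<subseteq> V \<and> (\<forall>x\<in>S. \<forall>u\<in>V. \<chi> u < \<chi> x \<longrightarrow> u \<in> S) \<and>
     inj_on f S \<and> f ` S \<subseteq> X \<and> (\<forall>e\<in>E. hybrid S f ` e \<in> R) \<and>
     (\<forall>z\<in>V - S. risk z S f
        \<le> \<eta> (\<chi> z) * K (\<chi> z) ^ card (earlier z \<inter> S) * real (card ({..<M} \<rightarrow>\<^sub>E X)))"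

lemma shadow_nbrs_subset: "shadow_nbrs E x \<subseteq> V"
  using E by (auto simp: shadow_nbrs_def nsets_def)

lemma finite_earlier: "finite (earlier x)"
  unfolding earlier_def using shadow_nbrs_subset finite_V by (auto intro: finite_subset)

lemma card_earlier_le:
  assumes "x \<in> V"
  shows "card (earlier x) \<le> M"
proof -
  have "card (earlier x) \<le> card (shadow_nbrs E x)"
    using finite_subset[OF shadow_nbrs_subset finite_V] by (intro card_mono) (auto simp: earlier_def)
  with shadow_degree[OF assms] show ?thesis by simp
qed

lemma nth_earlier_bij: "bij_betw (nth_earlier x) {..<card (earlier x)} (earlier x)"
proof -
  have "\<exists>h. bij_betw h {..<card (earlier x)} (earlier x)"
    using ex_bij_betw_nat_finite[OF finite_earlier] by (simp add: lessThan_atLeast0)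
  from someI_ex[OF this] show ?thesis unfolding nth_earlier_def .
qed

lemma nth_earlier_slot:
  assumes "u \<in> earlier x"
  shows "slot x u < card (earlier x)" "nth_earlier x (slot x u) = u"
proof -
  have mem: "u \<in> nth_earlier x ` {..<card (earlier x)}"
    using assms nth_earlier_bij[of x] by (simp add: bij_betw_def)
  have eq: "slot x u = inv_into {..<card (earlier x)} (nth_earlier x) u"
    using assms by (simp add: slot_def)
  show "slot x u < card (earlier x)" using inv_into_into[OF mem] unfolding eq by simp
  show "nth_earlier x (slot x u) = u" unfolding eq by (rule f_inv_into_f[OF mem])
qed

lemma pattern_subset:
  assumes "x \<in> V"
  shows "pattern x \<subseteq> ({..<M+r} - {M+\<chi> x}) \<times> ({..<M+r} - {M+\<chi> x})"
proof -
  have slot: "slot x u \<in> {..<M+r} - {M+\<chi> x}" if "u \<in> shadow_nbrs E x" for u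
  proof (cases "u \<in> earlier x")
    case True
    then show ?thesis using nth_earlier_slot[OF True] card_earlier_le[OF assms] by auto
  next
    case False
    moreover have "u \<in> V" using that shadow_nbrs_subset by auto
    ultimately show ?thesis using \<chi>_less proper[OF assms that] by (auto simp: slot_def)
  qed
  show ?thesis
  proof
    fix p assume "p \<in> pattern x"
    then obtain u w where p: "p = (slot x u, slot x w)" "{u, w, x} \<in> E" "u \<noteq> x" "w \<noteq> x"
      by (auto simp: pattern_def)
    from slot[OF shadow_nbrsI(1)[OF p(2,3)]] slot[OF shadow_nbrsI(2)[OF p(2,4)]]
    show "p \<in> ({..<M+r} - {M+\<chi> x}) \<times> ({..<M+r} - {M+\<chi> x})" unfolding p(1) by blast
  qed
qed

lemma hybrid_insert:
  "x \<notin> S \<Longrightarrow> hybrid (insert x S) (f(x := y)) u = (if u = x then y else hybrid S f u)"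
  by (auto simp: hybrid_def)

text \<open>
  All earlier neighbours of \<open>x\<close> lie in \<open>S\<close>, so filling their slots leaves no randomness that matters; as
  the proportion of deceptive fillings is still below \<open>1\<close>, the present situation is not
  deceptive. Since \<open>v (\<chi> x)\<close> is admissible by the invariant, there must be many admissible points.
\<close>
lemma many_candidates:
  assumes S: "safe S f" and x: "x \<in> V - S" and first: "\<And>u. u \<in> V - S \<Longrightarrow> \<chi> x \<le> \<chi> u"
  obtains C where "C \<subseteq> X" "real (card C) \<ge> \<delta> (\<chi> x) * real (card X)"
    "\<And>y e. y \<in> C \<Longrightarrow> e \<in> E \<Longrightarrow> hybrid (insert x S) (f(x := y)) ` e \<in> R"
proof -
  let ?F = "{..<M} \<rightarrow>\<^sub>E X"
  let ?i = "\<chi> x"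
  have "x \<in> V" using x by simp
  have F: "real (card ?F) > 0"
    using finite_X X_nonempty by (auto simp: card_gt_0_iff PiE_eq_empty_iff intro!: finite_PiE)
  have "risk x S f \<le> \<eta> ?i * K ?i ^ card (earlier x \<inter> S) * real (card ?F)"
    using S x by (auto simp: safe_def)
  also have "\<dots> < real (card ?F)"
  proof (cases "\<eta> ?i \<ge> 0")
    case True
    have "card (earlier x \<inter> S) \<le> M"
      using card_mono[OF finite_earlier, of "earlier x \<inter> S" x] card_earlier_le[OF \<open>x \<in> V\<close>] by simp
    then have "\<eta> ?i * K ?i ^ card (earlier x \<inter> S) \<le> \<eta> ?i * K ?i ^ M"
      using True K_ge[OF \<chi>_less[OF \<open>x \<in> V\<close>]] by (intro mult_left_mono power_increasing) auto
    then have "\<eta> ?i * K ?i ^ card (earlier x \<inter> S) < 1" using \<eta>_K[OF \<chi>_less[OF \<open>x \<in> V\<close>]] by simp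
    then show ?thesis using F by simp
  next
    case False
    then have "\<eta> ?i * K ?i ^ card (earlier x \<inter> S) \<le> 0"
      using K_ge[OF \<chi>_less[OF \<open>x \<in> V\<close>]] by (intro mult_nonpos_nonneg) auto
    then show ?thesis using F by (smt (verit) mult_nonpos_nonneg)
  qed
  finally have "card {a \<in> ?F. deceptive X R M (\<delta> ?i) (pattern x) ?i v (fill x S f a)} \<noteq> card ?F"
    by (simp add: risk_def)
  then obtain a where a: "\<not> deceptive X R M (\<delta> ?i) (pattern x) ?i v (fill x S f a)" by force
  define b where "b = join M (fill x S f a) v"
  \<comment> \<open>The filled slots and the template describe exactly the present partial embedding
      around \<open>x\<close>.\<close>
  have b: "b (slot x u) = hybrid S f u" if "u \<in> shadow_nbrs E x" for u
  proof (cases "u \<in> earlier x")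
    case True
    then have "u \<in> S" using that first[of u] shadow_nbrs_subset by (force simp: earlier_def)
    then show ?thesis using nth_earlier_slot[OF True] card_earlier_le[OF \<open>x \<in> V\<close>]
      by (auto simp: b_def join_def fill_def hybrid_def)
  next
    case False
    then have "\<chi> x < \<chi> u" using proper[OF \<open>x \<in> V\<close> that] that by (auto simp: earlier_def)
    then have "u \<notin> S" using S x by (auto simp: safe_def)
    then show ?thesis using False by (auto simp: b_def join_def slot_def hybrid_def)
  qed
  define C where "C = extensions X R (pattern x) b"
  have C_iff: "y \<in> C \<longleftrightarrow> y \<in> X \<and>
      (\<forall>u w. {u, w, x} \<in> E \<and> u \<noteq> x \<and> w \<noteq> x \<longrightarrow> {hybrid S f u, hybrid S f w, y} \<in> R)" for y
  proof -
    have "{b (slot x u), b (slot x w), y} = {hybrid S f u, hybrid S f w, y}"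
      if "{u, w, x} \<in> E" "u \<noteq> x" "w \<noteq> x" for u w
      using b[OF shadow_nbrsI(1)[OF that(1,2)]] b[OF shadow_nbrsI(2)[OF that(1,3)]] by simp
    then show ?thesis by (fastforce simp: C_def extensions_def pattern_def)
  qed
  have "v ?i \<in> C"
    unfolding C_iff
  proof (intro conjI allI impI)
    show "v ?i \<in> X" using v_in \<chi>_less \<open>x \<in> V\<close> by auto
    fix u w assume "{u, w, x} \<in> E \<and> u \<noteq> x \<and> w \<noteq> x"
    then have "hybrid S f ` {u, w, x} \<in> R" using S by (auto simp: safe_def)
    moreover have "hybrid S f x = v ?i" using x by (simp add: hybrid_def)
    ultimately show "{hybrid S f u, hybrid S f w, v ?i} \<in> R" by simp
  qed
  then have "real (card C) \<ge> \<delta> ?i * real (card X)"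
    using a by (auto simp: deceptive_def C_def b_def)
  moreover have "hybrid (insert x S) (f(x := y)) ` e \<in> R" if y: "y \<in> C" and e: "e \<in> E" for y e
  proof (cases "x \<in> e")
    case True
    then obtain u w where uw: "e = {u, w, x}" "u \<noteq> w" "u \<noteq> x" "w \<noteq> x"
      using hyperedge_obtain E e by (metis subsetD)
    then have "{hybrid S f u, hybrid S f w, y} \<in> R" using y e C_iff by auto
    then show ?thesis using uw x by (simp add: hybrid_insert)
  next
    case False
    then have "hybrid (insert x S) (f(x := y)) ` e = hybrid S f ` e"
      using x by (intro image_cong refl) (auto simp: hybrid_insert)
    then show ?thesis using S e by (auto simp: safe_def)
  qed
  ultimately show ?thesis by (intro that[of C]) (auto simp: C_iff)
qed

lemma risk_insert_unrelated:
  assumes "x \<notin> earlier z"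
  shows "risk z (insert x S) (f(x := y)) = risk z S f"
proof -
  have "nth_earlier z k \<noteq> x" if "k < card (earlier z)" for k
    using that assms nth_earlier_bij[of z] by (auto simp: bij_betw_def)
  then have "fill z (insert x S) (f(x := y)) = fill z S f"
    by (auto simp: fill_def fun_eq_iff)
  then show ?thesis by (simp add: risk_def)
qed

lemma risk_insert_average:
  assumes "z \<in> V" "x \<in> earlier z" "x \<notin> S"
  shows "(\<Sum>y\<in>X. risk z (insert x S) (f(x := y))) = real (card X) * risk z S f"
proof -
  define k where "k = slot z x"
  have k: "k < card (earlier z)" "nth_earlier z k = x" using nth_earlier_slot[OF assms(2)] by (auto simp: k_def)
  have uniq: "nth_earlier z l = x \<longleftrightarrow> l = k" if "l < card (earlier z)" for l
    using that k nth_earlier_bij[of z] by (auto simp: bij_betw_def inj_on_def)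
  have "fill z (insert x S) (f(x := y)) a = fill z S f (a(k := y))" for y a
    using k uniq assms(3) by (auto simp: fill_def fun_eq_iff)
  moreover have "k < M" using k card_earlier_le[OF assms(1)] by simp
  ultimately show ?thesis unfolding risk_def
    using sum_card_resample_PiE[of k "{..<M}" X
        "\<lambda>a. deceptive X R M (\<delta> (\<chi> z)) (pattern z) (\<chi> z) v (fill z S f a)"] finite_X
    by simp
qed

text \<open>
  Markov's inequality for the average in \<open>risk_insert_average\<close>. For vanishing risk it gives nothing, but
  then the risk vanishes for every \<open>y\<close>.
\<close>
lemma few_risky:
  assumes "z \<in> V" "x \<in> earlier z" "x \<notin> S"
  shows "K (\<chi> z) * real (card {y \<in> X. risk z (insert x S) (f(x := y)) > K (\<chi> z) * risk z S f})
    \<le> real (card X)"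
proof -
  let ?g = "\<lambda>y. risk z (insert x S) (f(x := y))"
  have nonneg: "?g y \<ge> 0" for y by (simp add: risk_def)
  have rz: "risk z S f \<ge> 0" by (simp add: risk_def)
  show ?thesis
  proof (cases "risk z S f = 0")
    case True
    then have "(\<Sum>y\<in>X. ?g y) = 0" using risk_insert_average[OF assms] by simp
    then have "\<forall>y\<in>X. ?g y = 0" using sum_nonneg_eq_0_iff[of X ?g] finite_X nonneg by simp
    then have "{y \<in> X. ?g y > K (\<chi> z) * risk z S f} = {}" using True by auto
    then show ?thesis by (metis card.empty mult_zero_right of_nat_0 of_nat_0_le_iff)
  next
    case False
    have "K (\<chi> z) * risk z S f * real (card {y \<in> X. ?g y > K (\<chi> z) * risk z S f}) \<le> sum ?g X"
      by (intro markov_card finite_X nonneg)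
    also have "\<dots> = real (card X) * risk z S f" using risk_insert_average[OF assms] .
    finally have "risk z S f * (K (\<chi> z) * real (card {y \<in> X. ?g y > K (\<chi> z) * risk z S f}))
        \<le> risk z S f * real (card X)"
      by (simp add: mult_ac)
    moreover have "risk z S f > 0" using False rz by simp
    ultimately show ?thesis by (simp only: mult_le_cancel_left_pos)
  qed
qed

text \<open>
  A vertex of the smallest remaining class is embedded next. At most \<open>M\<close> other vertices have it as an
  earlier neighbour, and each of them forbids at most \<open>card X / K (\<chi> z)\<close> points, altogether at most half of
  the admissible ones. Fewer than half are occupied, by the
  size of \<open>X\<close>.
\<close>
lemma safe_extend:
  assumes S: "safe S f" and "S \<noteq> V"
  shows "\<exists>x\<in>V - S. \<exists>y. safe (insert x S) (f(x := y))"
proof -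
  have SV: "S \<subseteq> V" "finite S" using S finite_V by (auto simp: safe_def intro: finite_subset)
  then have "V - S \<noteq> {}" using assms by auto
  then obtain x where x: "x \<in> V - S" and first: "\<And>u. u \<in> V - S \<Longrightarrow> \<chi> x \<le> \<chi> u"
    using ex_has_least_nat[of "\<lambda>u. u \<in> V - S" _ \<chi>] by blast
  obtain C where C: "C \<subseteq> X" "real (card C) \<ge> \<delta> (\<chi> x) * real (card X)"
    "\<And>y e. y \<in> C \<Longrightarrow> e \<in> E \<Longrightarrow> hybrid (insert x S) (f(x := y)) ` e \<in> R"
    using many_candidates[OF S x first] by blast
  define Z where "Z = {z \<in> V. x \<in> earlier z}"
  define Bad where "Bad z = {y \<in> X. risk z (insert x S) (f(x := y)) > K (\<chi> z) * risk z S f}" for z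
  have Z: "finite Z" "card Z \<le> M"
  proof -
    have "Z \<subseteq> shadow_nbrs E x" by (auto simp: Z_def earlier_def shadow_nbrs_sym[of x])
    moreover have "finite (shadow_nbrs E x)" by (rule finite_subset[OF shadow_nbrs_subset finite_V])
    ultimately show "finite Z" "card Z \<le> M"
      using shadow_degree[of x] x by (auto intro: finite_subset dest: card_mono)
  qed
  have cX: "real (card X) > 0" using finite_X X_nonempty by (simp add: card_gt_0_iff)
  have \<delta>pos: "\<delta> (\<chi> x) > 0"
    using \<delta>_X[of "\<chi> x"] \<chi>_less[of x] x cX by (metis DiffD1 le_less_trans mult_nonneg_nonneg of_nat_0_le_iff zero_le_numeral zero_less_mult_pos2)
  have half: "real (card (\<Union>(Bad ` Z))) \<le> \<delta> (\<chi> x) * real (card X) / 2"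
  proof (cases "M = 0")
    case True
    then have "Z = {}" using Z by auto
    then show ?thesis using \<delta>pos by simp
  next
    case False
    have "real (card (\<Union>(Bad ` Z))) \<le> (\<Sum>z\<in>Z. real (card (Bad z)))"
      using card_UN_le[OF Z(1), of Bad] by (metis of_nat_le_iff of_nat_sum)
    also have "\<dots> \<le> (\<Sum>z\<in>Z. \<delta> (\<chi> x) * real (card X) / (2 * real M))"
    proof (rule sum_mono)
      fix z assume "z \<in> Z"
      then have z: "z \<in> V" "x \<in> earlier z" "\<chi> x < \<chi> z" by (auto simp: Z_def earlier_def)
      have "2 * real M * real (card (Bad z)) \<le> \<delta> (\<chi> x) * K (\<chi> z) * real (card (Bad z))"
        using \<delta>_K[OF z(3) \<chi>_less[OF z(1)]] by (intro mult_right_mono) auto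
      also have "\<dots> = \<delta> (\<chi> x) * (K (\<chi> z) * real (card (Bad z)))" by simp
      also have "\<dots> \<le> \<delta> (\<chi> x) * real (card X)"
        using few_risky[OF z(1,2), of S f] x \<delta>pos unfolding Bad_def by (intro mult_left_mono) auto
      finally show "real (card (Bad z)) \<le> \<delta> (\<chi> x) * real (card X) / (2 * real M)"
        using False by (simp add: field_simps)
    qed
    also have "\<dots> = real (card Z) * (\<delta> (\<chi> x) * real (card X) / (2 * real M))" by simp
    also have "\<dots> \<le> real M * (\<delta> (\<chi> x) * real (card X) / (2 * real M))"
      using Z \<delta>pos by (intro mult_right_mono) auto
    finally show ?thesis using False by simp
  qed
  have "real (card (f ` S)) \<le> real (card V)"
    using card_image_le[OF SV(2), of f] card_mono[OF finite_V SV(1)] by linarith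
  also have "\<dots> < \<delta> (\<chi> x) * real (card X) / 2" using \<delta>_X[of "\<chi> x"] \<chi>_less[of x] x by simp
  finally have "real (card (f ` S)) + real (card (\<Union>(Bad ` Z))) < real (card C)"
    using half C(2) by linarith
  moreover have fin: "finite (f ` S \<union> \<Union>(Bad ` Z))" using SV Z(1) finite_X by (auto simp: Bad_def)
  ultimately have "card (f ` S \<union> \<Union>(Bad ` Z)) < card C"
    using card_Un_le[of "f ` S" "\<Union>(Bad ` Z)"] by linarith
  then have "\<not> C \<subseteq> f ` S \<union> \<Union>(Bad ` Z)" using card_mono[OF fin, of C] by linarith
  then obtain y where y: "y \<in> C" "y \<notin> f ` S" "\<And>z. z \<in> Z \<Longrightarrow> y \<notin> Bad z" by auto
  have "safe (insert x S) (f(x := y))"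
    unfolding safe_def
  proof (intro conjI ballI impI)
    show "insert x S \<subseteq> V" using SV x by auto
    show "u \<in> insert x S" if "w \<in> insert x S" "u \<in> V" "\<chi> u < \<chi> w" for w u
      using that S first[of u] by (auto simp: safe_def)
    show "inj_on (f(x := y)) (insert x S)"
      using S y(2) x by (auto simp: safe_def inj_on_def)
    show "(f(x := y)) ` insert x S \<subseteq> X" using S x y(1) C(1) by (auto simp: safe_def)
    show "hybrid (insert x S) (f(x := y)) ` e \<in> R" if "e \<in> E" for e using C(3) y(1) that .
    fix z assume z: "z \<in> V - insert x S"
    let ?c = "real (card ({..<M} \<rightarrow>\<^sub>E X))" and ?k = "card (earlier z \<inter> S)"
    have IH: "risk z S f \<le> \<eta> (\<chi> z) * K (\<chi> z) ^ ?k * ?c" using S z by (auto simp: safe_def)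
    show "risk z (insert x S) (f(x := y)) \<le> \<eta> (\<chi> z) * K (\<chi> z) ^ card (earlier z \<inter> insert x S) * ?c"
    proof (cases "x \<in> earlier z")
      case True
      have "y \<notin> Bad z" using y(3) True z by (auto simp: Z_def)
      then have "risk z (insert x S) (f(x := y)) \<le> K (\<chi> z) * risk z S f"
        using y(1) C(1) by (auto simp: Bad_def)
      also have "\<dots> \<le> K (\<chi> z) * (\<eta> (\<chi> z) * K (\<chi> z) ^ ?k * ?c)"
        using IH K_ge[of "\<chi> z"] \<chi>_less z by (intro mult_left_mono) (auto intro: order_trans[of 0 1])
      also have "card (earlier z \<inter> insert x S) = Suc ?k"
        using True x finite_earlier[of z] by simp
      then have "K (\<chi> z) * (\<eta> (\<chi> z) * K (\<chi> z) ^ ?k * ?c)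
          = \<eta> (\<chi> z) * K (\<chi> z) ^ card (earlier z \<inter> insert x S) * ?c" by simp
      finally show ?thesis .
    next
      case False
      then show ?thesis using IH by (simp add: risk_insert_unrelated)
    qed
  qed
  then show ?thesis using x by auto
qed

lemma safe_empty: "safe {} f"
proof -
  have "hybrid {} f ` e = v ` \<chi> ` e" for e by (auto simp: hybrid_def image_image)
  moreover have "fill z {} f a = a" for z a by (simp add: fill_def fun_eq_iff)
  ultimately show ?thesis
    using v_edge honest[OF _ pattern_subset] by (simp add: safe_def risk_def)
qed

text \<open>
  Started from the homomorphism given by the template alone, the extension step is repeated until
  every template point has been replaced.
\<close>
theorem embedding: "\<exists>f. inj_on f V \<and> f ` V \<subseteq> X \<and> (\<forall>e\<in>E. f ` e \<in> R)"
proof -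
  have "\<exists>f. safe V f" if "safe S f" for S f
    using that
  proof (induction "card (V - S)" arbitrary: S f rule: less_induct)
    case less
    show ?case
    proof (cases "S = V")
      case False
      then obtain x y where x: "x \<in> V - S" and s: "safe (insert x S) (f(x := y))"
        using safe_extend[OF less.prems] by blast
      have "card (V - insert x S) < card (V - S)"
        using x finite_V by (intro psubset_card_mono) auto
      from less.hyps[OF this s] show ?thesis .
    qed (use less.prems in auto)
  qed
  then obtain f where f: "safe V f" using safe_empty by blast
  have "f ` e \<in> R" if "e \<in> E" for e
  proof -
    have "hybrid V f ` e = f ` e" using that E by (intro image_cong) (auto simp: hybrid_def nsets_def)
    then show ?thesis using f that by (auto simp: safe_def)
  qed
  then show ?thesis using f by (auto simp: safe_def)
qed

end

section \<open>Bounded degree and the constants\<close>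

lemma greedy_colouring:
  fixes nbrs :: "'a \<Rightarrow> 'a set"
  assumes "finite V" and sym: "\<And>x u. u \<in> nbrs x \<longleftrightarrow> x \<in> nbrs u" and irrefl: "\<And>x. x \<notin> nbrs x"
    and deg: "\<And>x. x \<in> V \<Longrightarrow> card (nbrs x \<inter> V) \<le> D"
  obtains \<kappa> :: "'a \<Rightarrow> nat" where "\<kappa> ` V \<subseteq> {..D}"
    "\<And>x u. x \<in> V \<Longrightarrow> u \<in> V \<Longrightarrow> u \<in> nbrs x \<Longrightarrow> \<kappa> u \<noteq> \<kappa> x"
proof -
  have "\<exists>\<kappa> :: 'a \<Rightarrow> nat. \<kappa> ` W \<subseteq> {..D} \<and> (\<forall>x\<in>W. \<forall>u\<in>W. u \<in> nbrs x \<longrightarrow> \<kappa> u \<noteq> \<kappa> x)" if "W \<subseteq> V" for W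
    using finite_subset[OF that assms(1)] that
  proof (induction W rule: finite_induct)
    case (insert y W)
    then obtain \<kappa> :: "'a \<Rightarrow> nat" where \<kappa>: "\<kappa> ` W \<subseteq> {..D}"
      "\<And>x u. x \<in> W \<Longrightarrow> u \<in> W \<Longrightarrow> u \<in> nbrs x \<Longrightarrow> \<kappa> u \<noteq> \<kappa> x" by auto
    have fin: "finite (nbrs y \<inter> W)" using insert.hyps by simp
    have "card (\<kappa> ` (nbrs y \<inter> W)) \<le> card (nbrs y \<inter> W)" by (rule card_image_le[OF fin])
    also have "\<dots> \<le> card (nbrs y \<inter> V)" using insert.prems assms(1) by (intro card_mono) auto
    also have "\<dots> \<le> D" using deg insert.prems by simp
    finally have "card (\<kappa> ` (nbrs y \<inter> W)) < card {..D}" by simp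
    then have "\<not> {..D} \<subseteq> \<kappa> ` (nbrs y \<inter> W)"
      using card_mono[OF finite_imageI[OF fin], of "{..D}" \<kappa>] by linarith
    then obtain c where c: "c \<le> D" "c \<notin> \<kappa> ` (nbrs y \<inter> W)" by auto
    have "(\<kappa>(y := c)) ` insert y W \<subseteq> {..D}" using \<kappa>(1) c(1) by auto
    moreover have "(\<kappa>(y := c)) u \<noteq> (\<kappa>(y := c)) x"
      if xu: "x \<in> insert y W" "u \<in> insert y W" "u \<in> nbrs x" for x u
    proof -
      have "u \<noteq> x" using xu(3) irrefl by auto
      consider "x = y" "u \<in> W" | "u = y" "x \<in> W" "x \<noteq> y" | "x \<noteq> y" "u \<noteq> y" "x \<in> W" "u \<in> W"
        using xu(1,2) \<open>u \<noteq> x\<close> by blast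
      then show ?thesis
      proof cases
        case 1
        then show ?thesis using c(2) xu(3) \<open>u \<noteq> x\<close> by auto
      next
        case 2
        then show ?thesis using c(2) xu(3) sym[of u x] by auto
      next
        case 3
        then show ?thesis using \<kappa>(2) xu(3) by auto
      qed
    qed
    ultimately show ?case by blast
  qed simp
  from this[OF order_refl] obtain \<kappa> :: "'a \<Rightarrow> nat"
    where "\<kappa> ` V \<subseteq> {..D}" "\<forall>x\<in>V. \<forall>u\<in>V. u \<in> nbrs x \<longrightarrow> \<kappa> u \<noteq> \<kappa> x"
    by (elim exE conjE)
  then show ?thesis by (intro that[of \<kappa>]) simp_all
qed

lemma card_shadow_nbrs_le:
  assumes "hypergraph3 V E" "max_degree V E \<le> \<Delta>" "x \<in> V"
  shows "card (shadow_nbrs E x) \<le> 2 * \<Delta>"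
proof -
  have V: "finite V" and E: "E \<subseteq> nsets V 3" using assms(1) by (auto simp: hypergraph3_def)
  let ?Ex = "{e \<in> E. x \<in> e}"
  have fin: "finite ?Ex" using finite_subset[OF E finite_imp_finite_nsets[OF V]] by simp
  have links: "shadow_nbrs E x = (\<Union>e\<in>?Ex. e - {x})" by (auto simp: shadow_nbrs_def)
  have "card (shadow_nbrs E x) \<le> (\<Sum>e\<in>?Ex. card (e - {x}))"
    unfolding links by (rule card_UN_le[OF fin])
  also have "\<dots> = (\<Sum>e\<in>?Ex. 2)" using E by (intro sum.cong refl) (auto simp: nsets_def)
  also have "\<dots> = 2 * vertex_degree E x" by (simp add: vertex_degree_def)
  also have "vertex_degree E x \<le> max_degree V E"
    using V assms(3) by (auto simp: max_degree_def intro: Max_ge)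
  finally show ?thesis using assms(2) by simp
qed

text \<open>
  The sequence \<open>\<delta>\<close>, which decides how many points count as many. With \<open>K\<close> and \<open>\<eta>\<close> eliminated its
  recursion reads as follows: \<open>K (Suc i) = 2 * M / \<delta> i\<close> is the least value that the Markov step
  tolerates, \<open>\<eta> (Suc i)\<close> is \<open>1 / (2 * K (Suc i) ^ M)\<close>, and \<open>\<delta> (Suc i)\<close> is smaller than \<open>\<eta> (Suc i)\<close> by the
  factor that the union bound over the shapes costs.
\<close>
primrec threshold :: "real \<Rightarrow> nat \<Rightarrow> nat \<Rightarrow> real" where
  "threshold q M 0 = q"
| "threshold q M (Suc i) = q * (threshold q M i / (2 * M)) ^ M"

lemma threshold_bounds:
  assumes "0 < q" "q \<le> 1" "M > 0"
  shows "0 < threshold q M i" "threshold q M i \<le> 1" "threshold q M (Suc i) \<le> threshold q M i"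
proof -
  have *: "0 < threshold q M i \<and> threshold q M i \<le> 1" for i
  proof (induction i)
    case (Suc i)
    then have "0 < threshold q M i / (2 * M)" "threshold q M i / (2 * M) \<le> 1"
      using assms by (auto simp: divide_le_eq)
    then have "0 < (threshold q M i / (2 * M)) ^ M" "(threshold q M i / (2 * M)) ^ M \<le> 1"
      by (auto intro!: power_le_one)
    then show ?case using assms by (auto intro: mult_le_one)
  qed (use assms in auto)
  then show "0 < threshold q M i" "threshold q M i \<le> 1" by auto
  let ?t = "threshold q M i / (2 * M)"
  have t: "0 < ?t" "?t \<le> 1" using *[of i] assms by (auto simp: divide_le_eq)
  have "?t ^ M \<le> ?t" using power_decreasing[of 1 M ?t] t assms by simp
  also have "\<dots> \<le> threshold q M i" using *[of i] assms by (simp add: divide_le_eq)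
  finally have "q * ?t ^ M \<le> 1 * threshold q M i"
    using t assms by (intro mult_mono) auto
  then show "threshold q M (Suc i) \<le> threshold q M i" by simp
qed

lemma threshold_antimono:
  assumes "0 < q" "q \<le> 1" "M > 0" "i \<le> j"
  shows "threshold q M j \<le> threshold q M i"
  using assms(4)
  by (rule lift_Suc_antimono_le[of "threshold q M", rotated]) (rule threshold_bounds[OF assms(1-3)])

section \<open>The linear bound\<close>

text \<open>
  The template is chosen before Ramsey's theorem is applied to its points, because honesty has to hold
  for whichever colour and indices Ramsey's theorem returns.
\<close>
lemma arrows_linear:
  "\<exists>C::nat. \<forall>(V::'a set) E. hypergraph3 V E \<and> max_degree V E \<le> \<Delta> \<and> V \<noteq> {} \<longrightarrow> arrows (C * card V) V E"
proof -
  define M where "M = 2 * \<Delta> + 1"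
  have "M > 0" by (simp add: M_def)
  obtain r0 :: nat where "partn_lst {..<r0} [M, M] 3" using ramsey_full by blast
  then have ramsey: "partn_lst {..<Suc r0} [M, M] 3" by (rule partn_lst_greater_resource) simp
  define r where "r = Suc r0"
  have "r > 0" by (simp add: r_def)
  \<comment> \<open>The cost of the union bound in \<open>exists_honest_template\<close>.\<close>
  define T where "T = 4 * real r * 2 ^ ((M + r)\<^sup>2)"
  have T: "T \<ge> 1"
  proof -
    have "1 * 1 \<le> (4 * real r) * 2 ^ ((M + r)\<^sup>2)" using \<open>r > 0\<close> by (intro mult_mono) auto
    then show ?thesis by (simp add: T_def)
  qed
  define q where "q = 1 / (2 * T)"
  have q: "0 < q" "q \<le> 1" using T by (auto simp: q_def divide_le_eq)
  define \<delta> where "\<delta> = threshold q M"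
  define K where "K j = (if j = 0 then 1 else 2 * real M / \<delta> (j - 1))" for j
  define \<eta> where "\<eta> j = 1 / (2 * K j ^ M)" for j
  note \<delta> = threshold_bounds[OF q \<open>M > 0\<close>, folded \<delta>_def]
  note \<delta>_anti = threshold_antimono[OF q \<open>M > 0\<close>, folded \<delta>_def]
  have K: "K j \<ge> 1" for j
  proof -
    have "\<delta> (j - 1) \<le> 2 * real M" using \<delta>(2)[of "j - 1"] \<open>M > 0\<close> by linarith
    then show ?thesis using \<delta>(1)[of "j - 1"] by (simp add: K_def le_divide_eq)
  qed
  have \<delta>T: "\<delta> i * T \<le> \<eta> i" for i
  proof -
    have "\<delta> i \<le> q * (1 / K i) ^ M"
      by (cases i) (simp_all add: \<delta>_def K_def)
    then have "\<delta> i * T \<le> q * (1 / K i) ^ M * T" using T by (intro mult_right_mono) auto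
    also have "\<dots> = \<eta> i" using T by (simp add: q_def \<eta>_def power_one_over)
    finally show ?thesis .
  qed
  have \<delta>K: "2 * real M \<le> \<delta> i * K j" if "i < j" for i j
  proof -
    have "2 * real M = \<delta> (j - 1) * K j" using that \<delta>(1)[of "j - 1"] by (simp add: K_def)
    also have "\<dots> \<le> \<delta> i * K j" using that K[of j] by (intro mult_right_mono \<delta>_anti) auto
    finally show ?thesis .
  qed
  have \<eta>K: "\<eta> j * K j ^ M < 1" and \<eta>: "\<eta> j > 0" for j
    using K[of j] by (auto simp: \<eta>_def)
  obtain C0 :: nat where C0: "2 / \<delta> r < real C0" using reals_Archimedean2 by blast
  define C where "C = C0 + 2 * r\<^sup>2 + 1"
  have "arrows (C * card V) V E"
    if VE: "hypergraph3 V E" "max_degree V E \<le> \<Delta>" "V \<noteq> {}" for V :: "'a set" and E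
    unfolding arrows_def
  proof
    fix c :: "nat set \<Rightarrow> bool"
    have V: "finite V" and E: "E \<subseteq> nsets V 3" using VE(1) by (auto simp: hypergraph3_def)
    have n: "card V \<ge> 1" using V VE(3) by (simp add: Suc_leI card_gt_0_iff)
    define X where "X = {..<C * card V}"
    define R where "R b = {e \<in> nsets X 3. c e = b}" for b
    have "2 * r\<^sup>2 < C * 1" by (simp add: C_def)
    also have "\<dots> \<le> card X" unfolding X_def card_lessThan using n by (rule mult_le_mono2)
    finally have big: "2 * r\<^sup>2 < card X" .
    have "finite X" by (simp add: X_def)
    obtain v where v: "v \<in> {..<r} \<rightarrow>\<^sub>E X" "inj_on v {..<r}"
      and honest: "\<And>b i P. i < r \<Longrightarrow> P \<subseteq> ({..<M+r} - {M+i}) \<times> ({..<M+r} - {M+i}) \<Longrightarrow>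
       real (card {a \<in> {..<M} \<rightarrow>\<^sub>E X. deceptive X (R b) M (\<delta> i) P i v a})
         \<le> \<eta> i * real (card ({..<M} \<rightarrow>\<^sub>E X))"
    proof (rule exists_honest_template[where R = R and \<delta> = \<delta> and \<eta> = \<eta> and M = M, OF \<open>finite X\<close> \<open>r > 0\<close> big])
      show "\<eta> i > 0" "\<delta> i \<ge> 0" for i using \<eta> \<delta>(1)[of i] by auto
      show "\<delta> i * real (4 * r * 2 ^ ((M + r)\<^sup>2)) \<le> \<eta> i" for i using \<delta>T[of i] by (simp add: T_def)
    qed blast
    define g where "g t = (if c (v ` t) then 0 else 1 :: nat)" for t
    have "g \<in> nsets {..<r} 3 \<rightarrow> {..<2}" by (simp add: g_def)
    from partn_lstE[OF ramsey[folded r_def] this]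
    obtain b0 I where b0: "b0 < 2" and I: "I \<in> nsets {..<r} ([M, M] ! b0)" "g ` nsets I 3 \<subseteq> {b0}"
      by (metis length_Cons list.size(3) numeral_2_eq_2)
    have I': "I \<subseteq> {..<r}" "finite I" "card I = M" using I(1) b0 by (auto simp: nsets_def less_2_cases_iff)
    define b where "b \<longleftrightarrow> b0 = 0"
    have mono: "v ` t \<in> R b" if "t \<in> nsets I 3" for t
    proof -
      have "c (v ` t) = b" using I(2) that by (auto simp: g_def b_def split: if_splits)
      moreover have "t \<subseteq> {..<r}" "finite t" "card t = 3" using that I'(1) by (auto simp: nsets_def)
      moreover from this have "inj_on v t" using v(2) by (meson inj_on_subset)
      ultimately show ?thesis using v(1) by (auto simp: R_def nsets_def card_image)
    qed
    obtain \<kappa> :: "'a \<Rightarrow> nat" where \<kappa>: "\<kappa> ` V \<subseteq> {..2 * \<Delta>}"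
      "\<And>x u. x \<in> V \<Longrightarrow> u \<in> V \<Longrightarrow> u \<in> shadow_nbrs E x \<Longrightarrow> \<kappa> u \<noteq> \<kappa> x"
    proof (rule greedy_colouring[OF V, of "shadow_nbrs E" "2 * \<Delta>"])
      show "card (shadow_nbrs E x \<inter> V) \<le> 2 * \<Delta>" if "x \<in> V" for x
      proof -
        have "shadow_nbrs E x \<inter> V = shadow_nbrs E x" using E by (auto simp: shadow_nbrs_def nsets_def)
        then show ?thesis using card_shadow_nbrs_le[OF VE(1,2) that] by simp
      qed
    qed (auto simp: shadow_nbrs_def)
    have "card I = card {..2 * \<Delta>}" using I'(3) by (simp add: M_def)
    then obtain h where h: "bij_betw h {..2 * \<Delta>} I" using I'(2) by (metis finite_same_card_bij finite_atMost)
    define \<chi> where "\<chi> = h \<circ> \<kappa>"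
    have \<chi>I: "\<chi> x \<in> I" if "x \<in> V" for x using that \<kappa>(1) h by (auto simp: \<chi>_def bij_betw_def)
    have \<chi>_proper: "\<chi> u \<noteq> \<chi> x" if "x \<in> V" "u \<in> V" "u \<in> shadow_nbrs E x" for x u
      using \<kappa>(2)[OF that] that(1,2) \<kappa>(1) h by (auto simp: \<chi>_def bij_betw_def inj_on_def)
    interpret template_embedding V E \<chi> X "R b" r M v \<delta> \<eta> K
    proof
      show "X \<noteq> {}" using big by auto
      show "\<chi> x < r" if "x \<in> V" for x using \<chi>I[OF that] I'(1) by auto
      show "\<chi> u \<noteq> \<chi> x" if "x \<in> V" "u \<in> shadow_nbrs E x" for x u
        using that E by (intro \<chi>_proper) (auto simp: shadow_nbrs_def nsets_def)
      show "card (shadow_nbrs E x) \<le> M" if "x \<in> V" for x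
        using card_shadow_nbrs_le[OF VE(1,2) that] by (simp add: M_def)
      show "v i \<in> X" if "i < r" for i using v(1) that by auto
      show "v ` \<chi> ` e \<in> R b" if "e \<in> E" for e
      proof (rule mono)
        have e: "e \<subseteq> V" "finite e" "card e = 3" using E that by (auto simp: nsets_def)
        have "inj_on \<chi> e"
        proof (rule inj_onI, rule ccontr)
          fix x u assume "x \<in> e" "u \<in> e" "\<chi> x = \<chi> u" "x \<noteq> u"
          moreover from this have "u \<in> shadow_nbrs E x" using that by (auto simp: shadow_nbrs_def)
          ultimately show False using \<chi>_proper[of x u] e(1) by auto
        qed
        then show "\<chi> ` e \<in> nsets I 3" using e \<chi>I by (auto simp: nsets_def card_image)
      qed
      show "2 * real (card V) < \<delta> i * real (card X)" if "i < r" for i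
      proof -
        have "2 < \<delta> r * real C0" using C0 \<delta>(1)[of r] by (simp add: divide_less_eq mult.commute)
        also have "\<dots> \<le> \<delta> i * real C"
          using \<delta>_anti[of i r] that \<delta>(1)[of i] by (intro mult_mono) (auto simp: C_def)
        finally have "2 * real (card V) < \<delta> i * real C * real (card V)"
          using n by (intro mult_strict_right_mono) auto
        then show ?thesis by (simp add: X_def mult.assoc)
      qed
      show "real (card {a \<in> {..<M} \<rightarrow>\<^sub>E X. deceptive X (R b) M (\<delta> (\<chi> x)) P (\<chi> x) v a})
         \<le> \<eta> (\<chi> x) * real (card ({..<M} \<rightarrow>\<^sub>E X))"
        if "x \<in> V" "P \<subseteq> ({..<M+r} - {M+\<chi> x}) \<times> ({..<M+r} - {M+\<chi> x})" for x P
        using that(2) \<chi>I[OF that(1)] I'(1) by (intro honest) auto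
    qed (use V E \<open>finite X\<close> K \<delta>K \<eta>K in auto)
    obtain f where f: "inj_on f V" "f ` V \<subseteq> X" "\<And>e. e \<in> E \<Longrightarrow> f ` e \<in> R b" using embedding by blast
    have "f ` e \<in> nsets (f ` V) 3" if "e \<in> E" for e
      using f(3)[OF that] that E by (auto simp: R_def nsets_def)
    then have "subhypergraph (f ` V) ((`) f ` E) X (nsets X 3)"
      using f V by (auto simp: subhypergraph_def hypergraph3_def R_def)
    moreover have "hypergraph_iso V E (f ` V) ((`) f ` E)"
      unfolding hypergraph_iso_def using f(1) by (intro exI[of _ f]) (simp add: bij_betw_def)
    moreover have "\<forall>e\<in>(`) f ` E. c e = b" using f(3) by (auto simp: R_def)
    ultimately show "\<exists>W F. subhypergraph W F {..<C * card V} (nsets {..<C * card V} 3) \<and>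
        hypergraph_iso V E W F \<and> (\<exists>b. \<forall>e\<in>F. c e = b)"
      unfolding X_def by blast
  qed
  then show ?thesis by blast
qed

text \<open>
  For the empty vertex set the bound forces the Ramsey number to be \<open>0\<close>, while a template needs
  a nonempty \<open>X\<close>.
\<close>
lemma arrows_empty:
  assumes "hypergraph3 {} E"
  shows "arrows 0 {} E"
proof -
  have "E = {}" using assms by (auto simp: hypergraph3_def nsets_def)
  then show ?thesis
    by (auto simp: arrows_def subhypergraph_def hypergraph3_def hypergraph_iso_def bij_betw_def)
qed

theorem theorem1:
  shows "\<forall>\<Delta>::nat. \<exists>C::real. \<forall>(V::'a set) (E::'a set set).
           hypergraph3 V E \<and> max_degree V E \<le> \<Delta> \<longrightarrow>
           real (ramsey_number V E) \<le> C * real (card V)"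
proof
  fix \<Delta> :: nat
  obtain C :: nat where C: "\<And>(V::'a set) E. hypergraph3 V E \<Longrightarrow> max_degree V E \<le> \<Delta> \<Longrightarrow> V \<noteq> {}
      \<Longrightarrow> arrows (C * card V) V E"
    using arrows_linear by blast
  have "ramsey_number V E \<le> C * card V" if "hypergraph3 V E" "max_degree V E \<le> \<Delta>" for V :: "'a set" and E
    unfolding ramsey_number_def using that C arrows_empty by (intro Least_le) (cases "V = {}"; simp)
  then show "\<exists>C::real. \<forall>(V::'a set) E. hypergraph3 V E \<and> max_degree V E \<le> \<Delta> \<longrightarrow>
      real (ramsey_number V E) \<le> C * real (card V)"
    by (metis of_nat_le_iff of_nat_mult)
qed

end
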